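(* Let $A=\{a_n\}_{n\in\mathbb{N}}\subset\mathbb{R}^d$ be a roughly shift-invariant multiset, and let $D>0$ be its density. Then $A$ is uniformly spread, and there exist a constant $C<\infty$ and a bijection $\Theta$ from $\mathbb{N}$ onto $D^{-1/d}\mathbb{Z}^d$ such that $$\sup_{n\in\mathbb{N}}|a_n-\Theta(n)|<C.$$
   Context: A discrete multiset in $\mathbb{R}^d$ is a sequence $A=\{a_n\}_{n\in\mathbb{N}}\subset\mathbb{R}^d$ without finite limit points, i.e. every ball contains $a_n$ for only finitely many indices $n$ (points may be repeated, the number of repetitions being the multiplicity). A discrete multiset $A=\{a_n\}_{n\in\mathbb{N}}$ is called roughly shift-invariant if there exists $L<\infty$ such that for every $x\in\mathbb{R}^d$ there is a bijection $\sigma_x:\mathbb{N}\to\mathbb{N}$ with $\sup_{n\in\mathbb{N}}|a_n+x-a_{\sigma_x(n)}|<L$ (with $L$ independent of $x$). The density of a roughly shift-invariant multiset $A$ is the number $D>0$ such that $\lim_{T\to\infty}\#\{n: a_n\in B(x,T)\}/m_d(B(x,T))=D$ uniformly in $x\in\mathbb{R}^d$; every roughly shift-invariant multiset has such a density. Here $m_d$ is $d$-dimensional Lebesgue measure and $B(x,T)$ is the open ball of radius $T$ centered at $x$. A discrete multiset $A=\{a_n\}_{n\in\mathbb{N}}\subset\mathbb{R}^d$ is called uniformly spread if for some $\alpha>0$ there exist a constant $C<\infty$ and a bijection $\sigma:\mathbb{N}\to\alpha^{-1/d}\mathbb{Z}^d$ such that $\sup_{n\in\mathbb{N}}|\sigma(n)-a_n|<C$.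 *)

theory Defs
  imports "HOL-Analysis.Analysis"
begin

text \<open>
  A multiset in \<open>d\<close>-dimensional space is a sequence \<open>A :: nat \<Rightarrow> real ^ 'n\<close> with \<open>d = CARD('n)\<close>;
  the multiplicity of a point is the number of indices at which it occurs. Suprema of
  distances are taken in the extended reals, where the supremum of an unbounded set is
  infinite; in \<open>real\<close> it would be an unspecified number.
\<close>

definition discrete_multiset :: "(nat \<Rightarrow> real ^ 'n::finite) \<Rightarrow> bool" where
  "discrete_multiset A \<longleftrightarrow> (\<forall>x r. finite {n. A n \<in> ball x r})"

definition roughly_shift_invariant :: "(nat \<Rightarrow> real ^ 'n::finite) \<Rightarrow> bool" where
  "roughly_shift_invariant A \<longleftrightarrow> discrete_multiset A \<and>
     (\<exists>L::real. \<forall>x. \<exists>\<sigma>::nat \<Rightarrow> nat. bij \<sigma> \<and>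
        (SUP n. ereal (norm (A n + x - A (\<sigma> n)))) < ereal L)"

definition has_density :: "(nat \<Rightarrow> real ^ 'n::finite) \<Rightarrow> real \<Rightarrow> bool" where
  "has_density A D \<longleftrightarrow> D > 0 \<and>
     uniform_limit UNIV
       (\<lambda>T x. real (card {n. A n \<in> ball x T}) / measure lebesgue (ball x T))
       (\<lambda>x. D) at_top"

definition integer_lattice :: "(real ^ 'n::finite) set" where
  "integer_lattice = {z. \<forall>i. z $ i \<in> \<int>}"

definition scaled_lattice :: "real \<Rightarrow> (real ^ 'n::finite) set" where
  "scaled_lattice \<alpha> = (\<lambda>z. (\<alpha> powr (- 1 / real CARD('n))) *\<^sub>R z) ` integer_lattice"

definition uniformly_spread :: "(nat \<Rightarrow> real ^ 'n::finite) \<Rightarrow> bool" where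
  "uniformly_spread A \<longleftrightarrow> discrete_multiset A \<and>
     (\<exists>\<alpha>>0. \<exists>C::real. \<exists>\<sigma>. bij_betw \<sigma> UNIV (scaled_lattice \<alpha>) \<and>
        (SUP n. ereal (norm (\<sigma> n - A n))) < ereal C)"

end

theory Submission
  imports Defs
begin

text \<open>
  Join an index \<open>n\<close> to a lattice point \<open>z\<close> when \<open>norm (A n - z) \<le> K\<close>, where \<open>K\<close> is the
  shift-invariance constant \<open>L\<close> plus a bound for the diameter of a lattice cell. This bipartite graph
  is locally finite, so it has a perfect matching as soon as Hall's condition holds on both sides;
  a perfect matching is the bijection \<open>\<Theta>\<close>.

  Hall's condition comes from averaging over translations. Let \<open>F\<close> be a finite set of indices and \<open>U\<close>
  the union of the balls of radius \<open>L\<close> about the points \<open>A n\<close>, \<open>n \<in> F\<close>. For every vector \<open>x\<close> the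
  bijection between \<open>A + x\<close> and \<open>A\<close> provides at least \<open>card F\<close> indices \<open>m\<close> with \<open>A m + x \<in> U\<close>.
  The mean of that number over \<open>x\<close> in a ball of large radius \<open>T\<close> can be computed by Fubini: it is
  the integral over \<open>u \<in> U\<close> of \<open>card {m. A m \<in> ball u T}\<close>, divided by the volume of the ball, and
  by the uniform density this tends to \<open>D\<close> times the volume of \<open>U\<close>. Therefore
  \<open>card F \<le> D * measure lebesgue U\<close>. The constant \<open>L\<close> is the same for all \<open>x\<close>, so letting \<open>T\<close> tend
  to infinity does not enlarge \<open>U\<close>. A lattice cell has volume \<open>1 / D\<close>, so at least \<open>card F\<close> cells are
  needed to cover \<open>U\<close>, and the corner of every cell meeting \<open>U\<close> is a neighbour of \<open>F\<close>.

  On the other side let \<open>V\<close> be the union of the cells at a finite set \<open>G\<close> of lattice points, of volume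
  \<open>card G / D\<close>. Whenever \<open>A m + x \<in> V\<close>, the partner of \<open>m\<close> is a neighbour of \<open>G\<close>; so the number
  of neighbours bounds \<open>card {m. A m + x \<in> V}\<close> for every \<open>x\<close>, and hence also the mean
  \<open>D * measure lebesgue V = card G\<close>.

  The two halves are \<open>hall_points_to_lattice\<close> and \<open>hall_lattice_to_points\<close>; the averaging is in
  \<open>translation_count_ge_imp_volume_ge\<close> and its counterpart, and the combinatorics in
  \<open>perfect_matching\<close>.
\<close>

section \<open>Perfect matchings in locally finite bipartite graphs\<close>

definition hall_condition :: "'a set \<Rightarrow> ('a \<Rightarrow> 'b set) \<Rightarrow> bool" where
  "hall_condition I N \<longleftrightarrow> (\<forall>F. finite F \<longrightarrow> F \<subseteq> I \<longrightarrow> card F \<le> card (\<Union> (N ` F)))"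

text \<open>
  Rado's exchange step. If deleting \<open>x\<close> violates the condition on \<open>J \<union> {i}\<close> and deleting \<open>y\<close> violates it
  on \<open>K \<union> {i}\<close>, let \<open>P\<close> and \<open>Q\<close> be the two neighbourhoods that are too small. Because \<open>x \<noteq> y\<close>, the union
  of \<open>P\<close> and \<open>Q\<close> recovers all of \<open>N i\<close>, so it has at least \<open>card (J \<union> K) + 1\<close> elements, while
  their intersection has at least \<open>card (J \<inter> K)\<close>. Adding up contradicts
  \<open>card P + card Q \<le> card J + card K\<close>.
\<close>

lemma hall_condition_remove_one:
  assumes hall: "hall_condition I N" and fin: "\<And>i. i \<in> I \<Longrightarrow> finite (N i)"
    and i: "i \<in> I" and xy: "x \<in> N i" "y \<in> N i" "x \<noteq> y"
  shows "hall_condition I (N(i := N i - {x})) \<or> hall_condition I (N(i := N i - {y}))"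
proof (rule ccontr)
  have violated: "\<exists>J. finite J \<and> J \<subseteq> I \<and> i \<notin> J \<and> card (\<Union> (N ` J) \<union> (N i - {v})) \<le> card J"
    if not_hall: "\<not> hall_condition I (N(i := N i - {v}))" for v
  proof -
    obtain F where F: "finite F" "F \<subseteq> I" "card (\<Union> ((N(i := N i - {v})) ` F)) < card F"
      using not_hall unfolding hall_condition_def by (auto simp: not_le)
    have "i \<in> F"
    proof (rule ccontr)
      assume "i \<notin> F"
      then have "\<Union> ((N(i := N i - {v})) ` F) = \<Union> (N ` F)" by auto
      then show False using F hall unfolding hall_condition_def by (metis not_le)
    qed
    then have "\<Union> ((N(i := N i - {v})) ` F) = \<Union> (N ` (F - {i})) \<union> (N i - {v})"
      by (auto split: if_splits)
    then have "card (\<Union> (N ` (F - {i})) \<union> (N i - {v})) \<le> card (F - {i})"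
      using F \<open>i \<in> F\<close> by simp
    then show ?thesis using F by (intro exI[of _ "F - {i}"]) auto
  qed
  assume "\<not> ?thesis"
  with violated obtain J K where
    J: "finite J" "J \<subseteq> I" "i \<notin> J" "card (\<Union> (N ` J) \<union> (N i - {x})) \<le> card J" and
    K: "finite K" "K \<subseteq> I" "i \<notin> K" "card (\<Union> (N ` K) \<union> (N i - {y})) \<le> card K"
    by meson
  define P where "P = \<Union> (N ` J) \<union> (N i - {x})"
  define Q where "Q = \<Union> (N ` K) \<union> (N i - {y})"
  have finPQ: "finite P" "finite Q" using J K i fin unfolding P_def Q_def by auto
  have "(N i - {x}) \<union> (N i - {y}) = N i" using \<open>x \<noteq> y\<close> by blast
  then have "P \<union> Q = \<Union> (N ` insert i (J \<union> K))"
    unfolding P_def Q_def image_insert image_Un Union_insert Union_Un_distrib by blast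
  moreover have "card (insert i (J \<union> K)) \<le> card (\<Union> (N ` insert i (J \<union> K)))"
    using hall[unfolded hall_condition_def, rule_format, of "insert i (J \<union> K)"] J(1,2) K(1,2) i
    by (meson finite_Un finite_insert insert_subset le_sup_iff)
  moreover have "card (insert i (J \<union> K)) = Suc (card (J \<union> K))" using J(1,3) K(1,3) by simp
  ultimately have union: "Suc (card (J \<union> K)) \<le> card (P \<union> Q)" by metis
  have "card (J \<inter> K) \<le> card (\<Union> (N ` (J \<inter> K)))"
    using hall[unfolded hall_condition_def, rule_format, of "J \<inter> K"] J(1,2) by blast
  also have "\<dots> \<le> card (P \<inter> Q)"
    by (rule card_mono) (use finPQ in \<open>simp, unfold P_def Q_def, blast\<close>)
  finally have inter: "card (J \<inter> K) \<le> card (P \<inter> Q)" .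
  have "card P + card Q = card (P \<union> Q) + card (P \<inter> Q)" by (rule card_Un_Int) (fact finPQ)+
  moreover have "card J + card K = card (J \<union> K) + card (J \<inter> K)" by (rule card_Un_Int) (fact J(1) K(1))+
  ultimately show False using union inter J(4) K(4) unfolding P_def[symmetric] Q_def[symmetric] by linarith
qed

text \<open>
  Rado's proof of Hall's theorem for families of any cardinality. By Zorn's lemma there is a maximal set \<open>M\<close>
  of edges whose deletion preserves the condition; the finiteness of the sets \<open>N i\<close> makes the
  unions of chains admissible. By the exchange step every \<open>i\<close> keeps exactly one neighbour, and Hall's
  condition for two-element sets says that these neighbours are distinct.
\<close>

theorem hall_marriage:
  assumes hall: "hall_condition I N" and fin: "\<And>i. i \<in> I \<Longrightarrow> finite (N i)"
  obtains f where "inj_on f I" "\<And>i. i \<in> I \<Longrightarrow> f i \<in> N i"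
proof -
  define rest where "rest X i = N i - X `` {i}" for X :: "('a \<times> 'b) set" and i
  define \<A> where "\<A> = {X. hall_condition I (rest X)}"
  have fin_rest: "finite (rest X i)" if "i \<in> I" for X i using fin that unfolding rest_def by auto
  have "\<exists>M\<in>\<A>. \<forall>X\<in>\<A>. M \<subseteq> X \<longrightarrow> X = M"
  proof (rule subset_Zorn_nonempty)
    have "rest {} = N" unfolding rest_def by auto
    then show "\<A> \<noteq> {}" using hall unfolding \<A>_def by auto
  next
    fix \<C> assume C: "\<C> \<noteq> {}" "subset.chain \<A> \<C>"
    have "card F \<le> card (\<Union> (rest (\<Union>\<C>) ` F))" if F: "finite F" "F \<subseteq> I" for F
    proof -
      \<comment> \<open>The sets \<open>N i\<close> with \<open>i \<in> F\<close> involve finitely many edges, so one member of the chain already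
        deletes all of those that the union deletes.\<close>
      define E where "E = Sigma F N \<inter> \<Union>\<C>"
      have "finite (Sigma F N)" using F fin by (intro finite_SigmaI) auto
      then have "finite E" "E \<subseteq> \<Union>\<C>" unfolding E_def by auto
      then obtain X where X: "X \<in> \<C>" "E \<subseteq> X"
        using finite_subset_Union_chain C by metis
      have "X \<in> \<A>" using X C unfolding subset.chain_def by auto
      then have "card F \<le> card (\<Union> (rest X ` F))"
        using F unfolding \<A>_def hall_condition_def by auto
      also have "\<dots> \<le> card (\<Union> (rest (\<Union>\<C>) ` F))"
      proof (rule card_mono)
        show "finite (\<Union> (rest (\<Union>\<C>) ` F))" using F fin_rest by auto
        show "\<Union> (rest X ` F) \<subseteq> \<Union> (rest (\<Union>\<C>) ` F)"
          using X unfolding rest_def E_def by blast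
      qed
      finally show ?thesis .
    qed
    then show "\<Union>\<C> \<in> \<A>" unfolding \<A>_def hall_condition_def by auto
  qed
  then obtain M where M: "hall_condition I (rest M)"
    and max: "\<And>X. hall_condition I (rest X) \<Longrightarrow> M \<subseteq> X \<Longrightarrow> X = M"
    unfolding \<A>_def by auto
  have single: "\<exists>v. rest M i = {v}" if i: "i \<in> I" for i
  proof -
    have "card {i} \<le> card (\<Union> (rest M ` {i}))"
      using M i unfolding hall_condition_def by blast
    then have "rest M i \<noteq> {}" by auto
    then obtain v where v: "v \<in> rest M i" by auto
    have "w = v" if w: "w \<in> rest M i" for w
    proof (rule ccontr)
      assume "w \<noteq> v"
      have "rest (insert (i, u) M) = (rest M)(i := rest M i - {u})" for u
        unfolding rest_def by (auto simp: fun_eq_iff)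
      then obtain u where u: "u \<in> rest M i" "hall_condition I (rest (insert (i, u) M))"
        using hall_condition_remove_one[OF M fin_rest i v w] \<open>w \<noteq> v\<close> v w by metis
      then show False using max[OF u(2)] unfolding rest_def by blast
    qed
    then show ?thesis using v by auto
  qed
  define f where "f i = the_elem (rest M i)" for i
  have f: "rest M i = {f i}" if "i \<in> I" for i using single[OF that] unfolding f_def by (metis the_elem_eq)
  have "inj_on f I"
  proof (rule inj_onI, rule ccontr)
    fix i j assume ij: "i \<in> I" "j \<in> I" "f i = f j" "i \<noteq> j"
    have "card {i, j} \<le> card (\<Union> (rest M ` {i, j}))"
      by (rule M[unfolded hall_condition_def, rule_format]) (use ij in auto)
    then show False using ij(3,4) by (simp add: f[OF ij(1)] f[OF ij(2)])
  qed
  moreover have "f i \<in> N i" if "i \<in> I" for i using f[OF that] unfolding rest_def by auto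
  ultimately show thesis by (rule that)
qed

text \<open>
  Banach's refinement of the Schroeder-Bernstein theorem: the bijection only uses pairs that belong to the graph of
  \<open>f\<close> or to the reversed graph of \<open>g\<close>. That is what makes it combine two one-sided matchings of
  the same bipartite graph.
\<close>

lemma banach_mapping:
  assumes f: "inj_on f X" "f ` X \<subseteq> Y" and g: "inj_on g Y" "g ` Y \<subseteq> X"
  obtains h where "bij_betw h X Y" "\<And>x. x \<in> X \<Longrightarrow> h x = f x \<or> g (h x) = x"
proof -
  define S where "S = lfp (\<lambda>Z. X - g ` (Y - f ` Z))"
  \<comment> \<open>\<open>S\<close> contains the points whose chain of preimages under \<open>g\<close> and \<open>f\<close> stops in \<open>X\<close>.\<close>
  have "mono (\<lambda>Z. X - g ` (Y - f ` Z))" by (rule monoI) blast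
  then have S: "S = X - g ` (Y - f ` S)" unfolding S_def by (rule lfp_unfold)
  then have SX: "S \<subseteq> X" and XS: "X - S = g ` (Y - f ` S)" using g(2) by blast+
  define h where "h x = (if x \<in> S then f x else inv_into Y g x)" for x
  have "bij_betw f S (f ` S)" using f SX by (auto simp: bij_betw_def inj_on_subset)
  then have 1: "bij_betw h S (f ` S)" by (rule bij_betw_cong[THEN iffD1, rotated]) (simp add: h_def)
  have "bij_betw g (Y - f ` S) (X - S)" using g XS by (auto simp: bij_betw_def inj_on_subset)
  then have "bij_betw (inv_into Y g) (X - S) (Y - f ` S)"
    using g by (intro bij_betw_inv_into_subset[of g Y "g ` Y"]) (auto simp: bij_betw_def XS)
  then have 2: "bij_betw h (X - S) (Y - f ` S)"
    by (rule bij_betw_cong[THEN iffD1, rotated]) (simp add: h_def)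
  have "bij_betw h (S \<union> (X - S)) (f ` S \<union> (Y - f ` S))"
    by (rule bij_betw_combine[OF 1 2]) auto
  moreover have "S \<union> (X - S) = X" "f ` S \<union> (Y - f ` S) = Y" using SX f(2) by auto
  ultimately have "bij_betw h X Y" by simp
  moreover have "h x = f x \<or> g (h x) = x" if "x \<in> X" for x
    using that XS unfolding h_def by (auto intro!: f_inv_into_f)
  ultimately show thesis by (rule that)
qed

lemma perfect_matching:
  assumes "hall_condition X (\<lambda>x. {y \<in> Y. R x y})" "hall_condition Y (\<lambda>y. {x \<in> X. R x y})"
    and "\<And>x. x \<in> X \<Longrightarrow> finite {y \<in> Y. R x y}" "\<And>y. y \<in> Y \<Longrightarrow> finite {x \<in> X. R x y}"
  obtains h where "bij_betw h X Y" "\<And>x. x \<in> X \<Longrightarrow> R x (h x)"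
proof -
  obtain f where f: "inj_on f X" "\<And>x. x \<in> X \<Longrightarrow> f x \<in> {y \<in> Y. R x y}"
    using hall_marriage[OF assms(1,3)] by blast
  obtain g where g: "inj_on g Y" "\<And>y. y \<in> Y \<Longrightarrow> g y \<in> {x \<in> X. R x y}"
    using hall_marriage[OF assms(2,4)] by blast
  have "f ` X \<subseteq> Y" "g ` Y \<subseteq> X" using f(2) g(2) by auto
  then obtain h where h: "bij_betw h X Y" "\<And>x. x \<in> X \<Longrightarrow> h x = f x \<or> g (h x) = x"
    using banach_mapping[OF f(1) _ g(1)] by blast
  have "R x (h x)" if "x \<in> X" for x
    using h(2)[OF that] f(2)[OF that] g(2)[of "h x"] bij_betwE[OF h(1)] that by auto
  with h(1) show thesis by (rule that)
qed

section \<open>Averaging point counts over translations\<close>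

lemma has_integral_card_members:
  fixes E :: "'b \<Rightarrow> 'a::euclidean_space set"
  assumes "finite M" "B \<in> lmeasurable" "\<And>m. m \<in> M \<Longrightarrow> E m \<in> lmeasurable"
  shows "((\<lambda>x. real (card {m \<in> M. x \<in> E m})) has_integral
           (\<Sum>m\<in>M. measure lebesgue (B \<inter> E m))) B"
proof -
  have "((\<lambda>x. \<Sum>m\<in>M. indicator (B \<inter> E m) x :: real) has_integral
           (\<Sum>m\<in>M. measure lebesgue (B \<inter> E m))) UNIV"
    by (intro has_integral_sum assms(1) fmeasurable.Int[OF assms(2,3)]
          lmeasurable_iff_has_integral[THEN iffD1])
  moreover have "(\<Sum>m\<in>M. indicator (B \<inter> E m) x :: real)
      = (if x \<in> B then real (card {m \<in> M. x \<in> E m}) else 0)" for x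
  proof (cases "x \<in> B")
    case True
    then have "(\<Sum>m\<in>M. indicator (B \<inter> E m) x :: real) = (\<Sum>m\<in>M. if x \<in> E m then 1 else 0)"
      by (intro sum.cong) (simp_all add: indicator_def)
    also have "\<dots> = real (card {m \<in> M. x \<in> E m})"
      using assms(1) by (simp flip: sum.inter_filter)
    finally show ?thesis using True by simp
  qed (simp add: indicator_def)
  ultimately show ?thesis by (simp add: has_integral_restrict_UNIV)
qed

lemma has_integral_const_lmeasurable:
  fixes B :: "'a::euclidean_space set" and k :: real
  assumes "B \<in> lmeasurable"
  shows "((\<lambda>x. k) has_integral k * measure lebesgue B) B"
proof -
  have "((\<lambda>x. k * indicator B x) has_integral k * measure lebesgue B) UNIV"
    using assms by (intro has_integral_mult_right) (simp flip: lmeasurable_iff_has_integral)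
  moreover have "k * indicator B x = (if x \<in> B then k else 0)" for x by (simp add: indicator_def)
  ultimately show ?thesis by (simp add: has_integral_restrict_UNIV)
qed

text \<open>
  The instance of Fubini's theorem behind the averaging. For a single index \<open>m\<close>, translation by \<open>A m\<close> maps
  the set of \<open>x \<in> ball 0 T\<close> with \<open>A m + x \<in> U\<close> onto \<open>U \<inter> ball (A m) T\<close>; both integrals are
  the sum of the volumes of these sets.
\<close>

lemma has_integral_translation_counts:
  fixes A :: "nat \<Rightarrow> real ^ 'n"
  assumes A: "discrete_multiset A" and U: "U \<in> lmeasurable" "bounded U"
  obtains S where
    "((\<lambda>x. real (card {m. A m + x \<in> U})) has_integral S) (ball 0 T)"
    "((\<lambda>u. real (card {m. A m \<in> ball u T})) has_integral S) U"
proof -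
  obtain R where R: "\<And>u. u \<in> U \<Longrightarrow> norm u \<le> R" using U(2) unfolding bounded_iff by auto
  \<comment> \<open>Only the points in this ball can contribute to either count.\<close>
  define M where "M = {m. A m \<in> ball 0 (R + T + 1)}"
  have finM: "finite M" using A unfolding discrete_multiset_def M_def by blast
  have M: "m \<in> M" if "u \<in> U" "dist u (A m) < T" for m u
    using R[OF that(1)] that(2) norm_triangle_ineq2[of "A m" u]
    unfolding M_def by (auto simp: dist_norm norm_minus_commute)
  have translate: "{x. A m + x \<in> U} = (+) (- A m) ` U" for m
  proof (intro set_eqI iffI)
    fix x assume "x \<in> {x. A m + x \<in> U}"
    then show "x \<in> (+) (- A m) ` U" by (intro rev_image_eqI[of "A m + x"]) auto
  qed auto
  have meas: "{x. A m + x \<in> U} \<in> lmeasurable" for m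
    unfolding translate by (rule measurable_translation[OF U(1)])
  have "measure lebesgue (ball 0 T \<inter> {x. A m + x \<in> U}) = measure lebesgue (U \<inter> ball (A m) T)" for m
  proof -
    have "(+) (A m) ` (ball 0 T \<inter> {x. A m + x \<in> U}) = U \<inter> ball (A m) T"
    proof (intro set_eqI iffI)
      fix u assume "u \<in> U \<inter> ball (A m) T"
      then show "u \<in> (+) (A m) ` (ball 0 T \<inter> {x. A m + x \<in> U})"
        by (intro rev_image_eqI[of "u - A m"]) (auto simp: dist_norm norm_minus_commute)
    qed (auto simp: dist_norm)
    then show ?thesis using measure_translation by metis
  qed
  then have int1: "((\<lambda>x. real (card {m \<in> M. x \<in> {x. A m + x \<in> U}})) has_integral
      (\<Sum>m\<in>M. measure lebesgue (U \<inter> ball (A m) T))) (ball 0 T)"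
    using has_integral_card_members[OF finM lmeasurable_ball[of 0 T] meas] by simp
  have eq1: "{m \<in> M. x \<in> {x. A m + x \<in> U}} = {m. A m + x \<in> U}" if "x \<in> ball 0 T" for x
    using M[of "A m + x" m for m] that by (auto simp: dist_norm)
  have 1: "((\<lambda>x. real (card {m. A m + x \<in> U})) has_integral
      (\<Sum>m\<in>M. measure lebesgue (U \<inter> ball (A m) T))) (ball 0 T)"
    by (rule has_integral_eq[OF _ int1]) (simp only: eq1)
  have eq2: "{m \<in> M. u \<in> ball (A m) T} = {m. A m \<in> ball u T}" if "u \<in> U" for u
    using M[OF that] by (auto simp: dist_commute)
  have 2: "((\<lambda>u. real (card {m. A m \<in> ball u T})) has_integral
      (\<Sum>m\<in>M. measure lebesgue (U \<inter> ball (A m) T))) U"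
    by (rule has_integral_eq[OF _ has_integral_card_members[OF finM U(1) lmeasurable_ball]])
      (simp only: eq2)
  from 1 2 show thesis by (rule that)
qed

lemma measure_ball_translate:
  fixes u :: "real ^ 'n"
  shows "measure lebesgue (ball u T) = measure lebesgue (ball (0 :: real ^ 'n) T)"
  by (metis add_0_right ball_translation measure_translation)

text \<open>
  Clearing the denominator in the density: one radius \<open>T\<close> serves all centres, and \<open>b\<close> is the common
  volume of the balls of that radius.
\<close>

lemma has_density_large_ball:
  fixes A :: "nat \<Rightarrow> real ^ 'n"
  assumes "has_density A D" "e > 0"
  obtains b T where "b > 0" "b = measure lebesgue (ball (0 :: real ^ 'n) T)"
    "\<And>u. (D - e) * b \<le> real (card {m. A m \<in> ball u T})"
    "\<And>u. real (card {m. A m \<in> ball u T}) \<le> (D + e) * b"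
proof -
  have "\<forall>\<^sub>F T in at_top. \<forall>u. dist (real (card {n. A n \<in> ball u T}) / measure lebesgue (ball u T)) D < e"
    using assms unfolding has_density_def uniform_limit_iff by simp
  from eventually_happens'[OF trivial_limit_at_top_linorder
      eventually_conj[OF this eventually_gt_at_top[of 0]]] obtain T where T: "T > 0"
    "\<And>u. dist (real (card {n. A n \<in> ball u T}) / measure lebesgue (ball u T)) D < e"
    by blast
  define b where "b = measure lebesgue (ball (0 :: real ^ 'n) T)"
  have "b > 0" using content_ball_pos[OF T(1), of "0 :: real ^ 'n"] unfolding b_def by simp
  have ratio: "D - e \<le> real (card {n. A n \<in> ball u T}) / b \<and>
      real (card {n. A n \<in> ball u T}) / b \<le> D + e" for u
  proof -
    have "\<bar>real (card {n. A n \<in> ball u T}) / b - D\<bar> < e"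
      using T(2)[of u] unfolding measure_ball_translate[of u T] b_def[symmetric] dist_real_def .
    then show ?thesis by linarith
  qed
  show thesis
    using ratio by (intro that[OF \<open>b > 0\<close> b_def])
      (simp_all only: pos_le_divide_eq[OF \<open>b > 0\<close>] pos_divide_le_eq[OF \<open>b > 0\<close>])
qed

text \<open>
  A bound that holds for the number of points of \<open>A + x\<close> in \<open>U\<close> for every \<open>x\<close> also holds for the mean over
  \<open>x\<close>, and by the density the means over large balls approach \<open>D * measure lebesgue U\<close>.
\<close>

lemma translation_count_ge_imp_volume_ge:
  fixes A :: "nat \<Rightarrow> real ^ 'n"
  assumes "discrete_multiset A" "has_density A D" "U \<in> lmeasurable" "bounded U"
    and count: "\<And>x. k \<le> card {m. A m + x \<in> U}"
  shows "real k \<le> D * measure lebesgue U"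
proof -
  define \<mu> where "\<mu> = measure lebesgue U"
  have "\<mu> \<ge> 0" unfolding \<mu>_def by simp
  have bound: "real k \<le> (D + e) * \<mu>" if e: "e > 0" for e
  proof -
    obtain b T where b: "b > 0" "b = measure lebesgue (ball (0 :: real ^ 'n) T)"
      "\<And>u. real (card {m. A m \<in> ball u T}) \<le> (D + e) * b"
      using has_density_large_ball[OF assms(2) e] by metis
    obtain S where S:
      "((\<lambda>x. real (card {m. A m + x \<in> U})) has_integral S) (ball 0 T)"
      "((\<lambda>u. real (card {m. A m \<in> ball u T})) has_integral S) U"
      using has_integral_translation_counts[OF assms(1,3,4)] by blast
    have "real k * b \<le> S"
      unfolding b(2) using count
      by (intro has_integral_le[OF has_integral_const_lmeasurable S(1)]) auto
    also have "S \<le> (D + e) * b * \<mu>"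
      unfolding \<mu>_def
      by (intro has_integral_le[OF S(2) has_integral_const_lmeasurable]) (use assms b in auto)
    finally show ?thesis using b(1) by (simp add: mult.assoc mult.left_commute mult.commute)
  qed
  show ?thesis unfolding \<mu>_def[symmetric]
  proof (rule field_le_epsilon)
    fix e :: real assume "e > 0"
    then have "real k \<le> (D + e / (\<mu> + 1)) * \<mu>" using \<open>\<mu> \<ge> 0\<close> by (intro bound) auto
    moreover have "e / (\<mu> + 1) * \<mu> \<le> e" using \<open>e > 0\<close> \<open>\<mu> \<ge> 0\<close> by (simp add: field_simps)
    ultimately show "real k \<le> D * \<mu> + e" by (simp add: distrib_right)
  qed
qed

lemma translation_count_le_imp_volume_le:
  fixes A :: "nat \<Rightarrow> real ^ 'n"
  assumes "discrete_multiset A" "has_density A D" "U \<in> lmeasurable" "bounded U"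
    and count: "\<And>x. card {m. A m + x \<in> U} \<le> k"
  shows "D * measure lebesgue U \<le> real k"
proof -
  define \<mu> where "\<mu> = measure lebesgue U"
  have "\<mu> \<ge> 0" unfolding \<mu>_def by simp
  have bound: "(D - e) * \<mu> \<le> real k" if e: "e > 0" for e
  proof -
    obtain b T where b: "b > 0" "b = measure lebesgue (ball (0 :: real ^ 'n) T)"
      "\<And>u. (D - e) * b \<le> real (card {m. A m \<in> ball u T})"
      using has_density_large_ball[OF assms(2) e] by metis
    obtain S where S:
      "((\<lambda>x. real (card {m. A m + x \<in> U})) has_integral S) (ball 0 T)"
      "((\<lambda>u. real (card {m. A m \<in> ball u T})) has_integral S) U"
      using has_integral_translation_counts[OF assms(1,3,4)] by blast
    have "(D - e) * b * \<mu> \<le> S"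
      unfolding \<mu>_def
      by (intro has_integral_le[OF has_integral_const_lmeasurable S(2)]) (use assms b in auto)
    also have "S \<le> real k * b"
      unfolding b(2) using count
      by (intro has_integral_le[OF S(1) has_integral_const_lmeasurable]) auto
    finally show ?thesis using b(1) by (simp add: mult.assoc mult.left_commute mult.commute)
  qed
  show ?thesis unfolding \<mu>_def[symmetric]
  proof (rule field_le_epsilon)
    fix e :: real assume "e > 0"
    then have "(D - e / (\<mu> + 1)) * \<mu> \<le> real k" using \<open>\<mu> \<ge> 0\<close> by (intro bound) auto
    moreover have "e / (\<mu> + 1) * \<mu> \<le> e" using \<open>e > 0\<close> \<open>\<mu> \<ge> 0\<close> by (simp add: field_simps)
    ultimately show "D * \<mu> \<le> real k + e" by (simp add: left_diff_distrib)
  qed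
qed

section \<open>Cells of a scaled integer lattice\<close>

text \<open>
  The factor in \<open>scaled_lattice\<close>, chosen so that a cube with this side has volume \<open>1 / \<alpha>\<close>; it depends
  on the dimension, which is passed as a type.
\<close>

definition cell_side :: "'n itself \<Rightarrow> real \<Rightarrow> real" where
  "cell_side _ \<alpha> = \<alpha> powr (- 1 / real CARD('n))"

text \<open>The corner opposite to \<open>z\<close> of the lattice cell at \<open>z\<close>.\<close>

definition cell_corner :: "real \<Rightarrow> real ^ 'n \<Rightarrow> real ^ 'n" where
  "cell_corner \<alpha> z = z + (\<chi> i. cell_side TYPE('n) \<alpha>)"

lemma cell_side_pos: "\<alpha> > 0 \<Longrightarrow> cell_side TYPE('n) \<alpha> > 0"
  unfolding cell_side_def by simp

lemma cell_side_power:
  assumes "\<alpha> > 0"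
  shows "cell_side TYPE('n::finite) \<alpha> ^ CARD('n) = 1 / \<alpha>"
proof -
  have "cell_side TYPE('n) \<alpha> ^ CARD('n) = \<alpha> powr ((- 1 / real CARD('n)) * real CARD('n))"
    using assms by (simp add: cell_side_def powr_powr flip: powr_realpow)
  also have "\<dots> = 1 / \<alpha>" using assms by (simp add: powr_minus_divide)
  finally show ?thesis .
qed

lemma scaled_lattice_iff:
  assumes "\<alpha> > 0"
  shows "(z :: real ^ 'n) \<in> scaled_lattice \<alpha> \<longleftrightarrow>
    (\<forall>i. \<exists>k::int. z $ i = cell_side TYPE('n) \<alpha> * of_int k)"
proof
  assume "z \<in> scaled_lattice \<alpha>"
  then show "\<forall>i. \<exists>k::int. z $ i = cell_side TYPE('n) \<alpha> * of_int k"
    unfolding scaled_lattice_def integer_lattice_def cell_side_def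
    by (auto elim!: Ints_cases) (metis Ints_cases)
next
  assume "\<forall>i. \<exists>k::int. z $ i = cell_side TYPE('n) \<alpha> * of_int k"
  then obtain k :: "'n \<Rightarrow> int" where k: "\<And>i. z $ i = cell_side TYPE('n) \<alpha> * of_int (k i)" by metis
  have "z = cell_side TYPE('n) \<alpha> *\<^sub>R (\<chi> i. of_int (k i))" by (simp add: vec_eq_iff k)
  then show "z \<in> scaled_lattice \<alpha>"
    unfolding scaled_lattice_def integer_lattice_def cell_side_def by auto
qed

text \<open>
  Closed cells cover the space and open cells are disjoint, and both have volume \<open>1 / \<alpha>\<close>. The closed
  ones serve for bounding a volume from above by a number of cells, the open ones for bounding it from
  below.
\<close>

lemma measure_closed_cell:
  fixes z :: "real ^ 'n"
  assumes "\<alpha> > 0"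
  shows "measure lebesgue (cbox z (cell_corner \<alpha> z)) = 1 / \<alpha>"
proof -
  have "cbox z (cell_corner \<alpha> z) \<noteq> {}"
    using cell_side_pos[OF assms, where 'n = 'n]
    by (auto simp: cell_corner_def mem_box_cart intro!: exI[of _ z] simp flip: ex_in_conv)
  then show ?thesis
    using cell_side_power[OF assms, where 'n = 'n] by (simp add: content_cbox_cart cell_corner_def)
qed

lemma measure_open_cell:
  fixes z :: "real ^ 'n"
  assumes "\<alpha> > 0"
  shows "measure lebesgue (box z (cell_corner \<alpha> z)) = 1 / \<alpha>"
  using measure_closed_cell[OF assms, of z] by (simp add: measure_lborel_box_eq measure_lborel_cbox_eq)

lemma closed_cells_cover:
  fixes u :: "real ^ 'n"
  assumes "\<alpha> > 0"
  obtains z where "z \<in> scaled_lattice \<alpha>" "u \<in> cbox z (cell_corner \<alpha> z)"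
proof -
  define c where "c = cell_side TYPE('n) \<alpha>"
  have c: "c > 0" unfolding c_def by (rule cell_side_pos[OF assms])
  define z :: "real ^ 'n" where "z = (\<chi> i. c * of_int \<lfloor>u $ i / c\<rfloor>)"
  have "c * of_int \<lfloor>u $ i / c\<rfloor> \<le> u $ i \<and> u $ i \<le> c * of_int \<lfloor>u $ i / c\<rfloor> + c" for i
  proof
    have "of_int \<lfloor>u $ i / c\<rfloor> \<le> u $ i / c" by simp
    then show "c * of_int \<lfloor>u $ i / c\<rfloor> \<le> u $ i"
      using c by (simp add: pos_le_divide_eq mult.commute del: of_int_floor_le)
    have "u $ i / c \<le> of_int \<lfloor>u $ i / c\<rfloor> + 1" by linarith
    then show "u $ i \<le> c * of_int \<lfloor>u $ i / c\<rfloor> + c" using c by (simp add: field_simps)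
  qed
  then have "u \<in> cbox z (cell_corner \<alpha> z)"
    by (simp add: mem_box_cart cell_corner_def z_def c_def)
  moreover have "z \<in> scaled_lattice \<alpha>"
    unfolding scaled_lattice_iff[OF assms] by (auto simp: z_def c_def)
  ultimately show thesis by (intro that)
qed

lemma open_cells_disjoint:
  fixes y z :: "real ^ 'n"
  assumes "\<alpha> > 0" "y \<in> scaled_lattice \<alpha>" "z \<in> scaled_lattice \<alpha>"
    "u \<in> box y (cell_corner \<alpha> y)" "u \<in> box z (cell_corner \<alpha> z)"
  shows "y = z"
proof -
  define c where "c = cell_side TYPE('n) \<alpha>"
  have c: "c > 0" unfolding c_def by (rule cell_side_pos[OF assms(1)])
  have "y $ i = z $ i" for i
  proof -
    obtain k l :: int where kl: "y $ i = c * of_int k" "z $ i = c * of_int l"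
      using assms(2,3) unfolding scaled_lattice_iff[OF assms(1)] c_def by meson
    have "y $ i < u $ i" "u $ i < y $ i + c" "z $ i < u $ i" "u $ i < z $ i + c"
      using assms(4,5) by (auto simp: mem_box_cart cell_corner_def c_def)
    then have "c * of_int k < c * of_int (l + 1)" "c * of_int l < c * of_int (k + 1)"
      unfolding kl by (auto simp: algebra_simps)
    then have "k < l + 1" "l < k + 1" using c by (auto simp only: mult_less_cancel_left_pos of_int_less_iff)
    then show ?thesis using kl by simp
  qed
  then show ?thesis by (simp add: vec_eq_iff)
qed

lemma norm_diff_closed_cell:
  fixes u z :: "real ^ 'n"
  assumes "u \<in> cbox z (cell_corner \<alpha> z)"
  shows "norm (u - z) \<le> real CARD('n) * cell_side TYPE('n) \<alpha>"
proof -
  have "norm (u - z) \<le> (\<Sum>i\<in>UNIV. \<bar>(u - z) $ i\<bar>)" by (rule norm_le_l1_cart)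
  also have "\<dots> \<le> (\<Sum>i\<in>(UNIV :: 'n set). cell_side TYPE('n) \<alpha>)"
  proof (rule sum_mono)
    fix i
    show "\<bar>(u - z) $ i\<bar> \<le> cell_side TYPE('n) \<alpha>"
      using assms by (auto simp: mem_box_cart cell_corner_def abs_le_iff algebra_simps dest!: spec[of _ i])
  qed
  finally show ?thesis by simp
qed

lemma finite_scaled_lattice_bounded:
  assumes "\<alpha> > 0" "bounded B"
  shows "finite {z \<in> scaled_lattice \<alpha>. (z :: real ^ 'n) \<in> B}"
proof -
  define c where "c = cell_side TYPE('n) \<alpha>"
  have c: "c > 0" unfolding c_def by (rule cell_side_pos[OF assms(1)])
  obtain R where R: "\<And>z. z \<in> B \<Longrightarrow> norm z \<le> R" using assms(2) unfolding bounded_iff by auto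
  define K where "K = (\<lambda>k. c * of_int k) ` {- \<lceil>R / c\<rceil>..\<lceil>R / c\<rceil>}"
  have "finite (vec_lambda ` (PiE (UNIV :: 'n set) (\<lambda>_. K)) :: (real ^ 'n) set)"
    by (intro finite_imageI finite_PiE) (auto simp: K_def)
  moreover have "{z \<in> scaled_lattice \<alpha>. (z :: real ^ 'n) \<in> B} \<subseteq> vec_lambda ` (PiE UNIV (\<lambda>_. K))"
  proof
    fix z :: "real ^ 'n" assume z: "z \<in> {z \<in> scaled_lattice \<alpha>. z \<in> B}"
    have "z $ i \<in> K" for i
    proof -
      obtain k :: int where k: "z $ i = c * of_int k"
        using z unfolding scaled_lattice_iff[OF assms(1)] c_def by auto
      have "\<bar>z $ i\<bar> \<le> R" using component_le_norm_cart[of z i] R[of z] z by auto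
      then have "\<bar>of_int k\<bar> \<le> R / c" using c unfolding k by (simp add: abs_mult field_simps)
      then have "\<bar>k\<bar> \<le> \<lceil>R / c\<rceil>" by linarith
      then show ?thesis unfolding K_def k by (auto simp: abs_le_iff)
    qed
    then have "vec_nth z \<in> PiE UNIV (\<lambda>_. K)" by auto
    then show "z \<in> vec_lambda ` (PiE UNIV (\<lambda>_. K))" by (rule rev_image_eqI) simp
  qed
  ultimately show ?thesis by (rule finite_subset[rotated])
qed

section \<open>Matching a roughly shift-invariant multiset with a lattice\<close>

lemma discrete_multiset_finite_bounded:
  assumes "discrete_multiset A" "bounded B"
  shows "finite {n. A n \<in> B}"
proof -
  obtain r where "B \<subseteq> ball 0 r" using assms(2) bounded_subset_ballD by blast
  then have "{n. A n \<in> B} \<subseteq> {n. A n \<in> ball 0 r}" by auto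
  then show ?thesis using assms(1) finite_subset unfolding discrete_multiset_def by blast
qed

lemma discrete_multiset_finite_translate:
  assumes "discrete_multiset A" "bounded B"
  shows "finite {n. A n + x \<in> B}"
proof -
  have "{n. A n + x \<in> B} = {n. A n \<in> (+) (- x) ` B}"
    by (auto intro: rev_image_eqI[of "A n + x" for n])
  then show ?thesis
    using discrete_multiset_finite_bounded[OF assms(1) bounded_translation[OF assms(2)], of "- x"]
    by (simp only:)
qed

lemma roughly_shift_invariant_bound:
  assumes "roughly_shift_invariant A"
  obtains L where "\<And>x. \<exists>\<sigma>::nat \<Rightarrow> nat. bij \<sigma> \<and> (\<forall>n. norm (A n + x - A (\<sigma> n)) < L)"
proof -
  obtain L where L: "\<And>x. \<exists>\<sigma>::nat \<Rightarrow> nat. bij \<sigma> \<and> (SUP n. ereal (norm (A n + x - A (\<sigma> n)))) < ereal L"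
    using assms unfolding roughly_shift_invariant_def by blast
  have "norm (A n + x - A (\<sigma> n)) < L"
    if "(SUP n. ereal (norm (A n + x - A (\<sigma> n)))) < ereal L" for x \<sigma> n
    using le_less_trans[OF SUP_upper that, of n] by simp
  then show thesis using L by (intro that) blast
qed

text \<open>
  The points of \<open>A\<close> with index in \<open>F\<close> stay within \<open>L\<close> of a translate of \<open>A\<close>, so every translate has
  at least \<open>card F\<close> points in their \<open>L\<close>-neighbourhood \<open>U\<close>. By averaging \<open>U\<close> has volume at least
  \<open>card F / D\<close>, and covering it takes at least \<open>card F\<close> closed cells.
\<close>

lemma hall_points_to_lattice:
  fixes A :: "nat \<Rightarrow> real ^ 'n"
  assumes A: "discrete_multiset A" "has_density A D"
    and shift: "\<And>x. \<exists>\<sigma>::nat \<Rightarrow> nat. bij \<sigma> \<and> (\<forall>n. norm (A n + x - A (\<sigma> n)) < L)"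
    and K: "K = L + real CARD('n) * cell_side TYPE('n) D"
  shows "hall_condition UNIV (\<lambda>n. {z \<in> scaled_lattice D. norm (A n - z) \<le> K})"
  unfolding hall_condition_def
proof (intro allI impI)
  have D: "D > 0" using A(2) unfolding has_density_def by blast
  fix F :: "nat set" assume F: "finite F"
  define U where "U = (\<Union>n\<in>F. ball (A n) L)"
  define G where "G = (\<Union>n\<in>F. {z \<in> scaled_lattice D. norm (A n - z) \<le> K})"
  have "norm (A n - z) \<le> K \<longleftrightarrow> z \<in> cball (A n) K" for n z by (simp add: dist_norm)
  then have finG: "finite G"
    unfolding G_def
    by (simp only:) (intro finite_UN_I F finite_scaled_lattice_bounded[OF D bounded_cball])
  have U: "U \<in> lmeasurable" "bounded U"
    unfolding U_def by (intro fmeasurable.finite_UN F lmeasurable_ball)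
      (intro bounded_UN F ballI bounded_ball)
  have "card F \<le> card {m. A m + x \<in> U}" for x
  proof -
    obtain \<sigma> where \<sigma>: "bij \<sigma>" "\<And>n. norm (A n + x - A (\<sigma> n)) < L" using shift by blast
    have "inv \<sigma> ` F \<subseteq> {m. A m + x \<in> U}"
    proof
      fix m assume "m \<in> inv \<sigma> ` F"
      then have "\<sigma> m \<in> F" using bij_is_surj[OF \<sigma>(1)] by (auto simp: surj_f_inv_f)
      moreover have "A m + x \<in> ball (A (\<sigma> m)) L"
        using \<sigma>(2)[of m] by (simp add: dist_norm norm_minus_commute)
      ultimately show "m \<in> {m. A m + x \<in> U}" unfolding U_def by blast
    qed
    moreover have "inj_on (inv \<sigma>) F"
      by (rule inj_on_subset[OF bij_is_inj[OF bij_imp_bij_inv[OF \<sigma>(1)]] subset_UNIV])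
    ultimately show ?thesis
      by (intro card_inj_on_le[OF _ _ discrete_multiset_finite_translate[OF A(1) U(2)]])
  qed
  then have card_F: "real (card F) \<le> D * measure lebesgue U"
    by (rule translation_count_ge_imp_volume_ge[OF A U])
  have "measure lebesgue U \<le> measure lebesgue (\<Union>z\<in>G. cbox z (cell_corner D z))"
  proof (rule measure_mono_fmeasurable)
    show "U \<subseteq> (\<Union>z\<in>G. cbox z (cell_corner D z))"
    proof
      fix u assume "u \<in> U"
      then obtain n where n: "n \<in> F" "norm (A n - u) < L" unfolding U_def by (auto simp: dist_norm)
      obtain z where z: "z \<in> scaled_lattice D" "u \<in> cbox z (cell_corner D z)"
        using closed_cells_cover[OF D] by blast
      have "norm (A n - z) \<le> norm (A n - u) + norm (u - z)"
        using norm_triangle_ineq[of "A n - u" "u - z"] by simp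
      then have "norm (A n - z) \<le> K" using n norm_diff_closed_cell[OF z(2)] unfolding K by simp
      then show "u \<in> (\<Union>z\<in>G. cbox z (cell_corner D z))" using n z unfolding G_def by blast
    qed
    show "U \<in> sets lebesgue" by (rule fmeasurableD[OF U(1)])
    show "(\<Union>z\<in>G. cbox z (cell_corner D z)) \<in> lmeasurable"
      by (intro fmeasurable.finite_UN finG lmeasurable_cbox)
  qed
  also have "\<dots> \<le> (\<Sum>z\<in>G. measure lebesgue (cbox z (cell_corner D z)))"
    by (rule measure_UNION_le) (use finG in auto)
  also have "\<dots> = real (card G) / D" by (simp add: measure_closed_cell[OF D] del: measure_completion)
  finally have "D * measure lebesgue U \<le> real (card G)"
    unfolding pos_le_divide_eq[OF D] mult.commute[of D] .
  with card_F have "real (card F) \<le> real (card G)" by linarith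
  then show "card F \<le> card (\<Union>n\<in>F. {z \<in> scaled_lattice D. norm (A n - z) \<le> K})"
    unfolding G_def by simp
qed

text \<open>
  The dual argument: the cells at the points of \<open>G\<close> have total volume \<open>card G / D\<close>, so by averaging
  some translate of \<open>A\<close> has at least \<open>card G\<close> points in them, and the partners of these in \<open>A\<close> are
  distinct neighbours of \<open>G\<close>.
\<close>

lemma hall_lattice_to_points:
  fixes A :: "nat \<Rightarrow> real ^ 'n"
  assumes A: "discrete_multiset A" "has_density A D"
    and shift: "\<And>x. \<exists>\<sigma>::nat \<Rightarrow> nat. bij \<sigma> \<and> (\<forall>n. norm (A n + x - A (\<sigma> n)) < L)"
    and K: "K = L + real CARD('n) * cell_side TYPE('n) D"
  shows "hall_condition (scaled_lattice D) (\<lambda>z. {n. norm (A n - z) \<le> K})"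
  unfolding hall_condition_def
proof (intro allI impI)
  have D: "D > 0" using A(2) unfolding has_density_def by blast
  fix G :: "(real ^ 'n) set" assume G: "finite G" "G \<subseteq> scaled_lattice D"
  define V where "V = (\<Union>z\<in>G. box z (cell_corner D z))"
  define W where "W = (\<Union>z\<in>G. {n. norm (A n - z) \<le> K})"
  have "norm (A n - z) \<le> K \<longleftrightarrow> A n \<in> cball z K" for n z
    by (simp add: dist_norm norm_minus_commute)
  then have finW: "finite W"
    unfolding W_def
    by (simp only:) (intro finite_UN_I G(1) discrete_multiset_finite_bounded[OF A(1) bounded_cball])
  have V: "V \<in> lmeasurable" "bounded V"
    unfolding V_def by (intro fmeasurable.finite_UN G(1) lmeasurable_box)
      (intro bounded_UN G(1) ballI bounded_box)
  have count: "card {m. A m + x \<in> V} \<le> card W" for x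
  proof -
    obtain \<sigma> where \<sigma>: "bij \<sigma>" "\<And>n. norm (A n + x - A (\<sigma> n)) < L" using shift by blast
    have "\<sigma> m \<in> W" if m: "A m + x \<in> V" for m
    proof -
      obtain z where z: "z \<in> G" "A m + x \<in> cbox z (cell_corner D z)"
        using m box_subset_cbox unfolding V_def by blast
      have "norm (A (\<sigma> m) - z) \<le> norm (A (\<sigma> m) - (A m + x)) + norm (A m + x - z)"
        using norm_triangle_ineq[of "A (\<sigma> m) - (A m + x)" "A m + x - z"] by simp
      also have "\<dots> \<le> K"
        using \<sigma>(2)[of m] norm_diff_closed_cell[OF z(2)] unfolding K
        by (simp add: norm_minus_commute)
      finally show ?thesis using z(1) unfolding W_def by auto
    qed
    moreover have "inj_on \<sigma> {m. A m + x \<in> V}"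
      by (rule inj_on_subset[OF bij_is_inj[OF \<sigma>(1)] subset_UNIV])
    ultimately show ?thesis using finW by (intro card_inj_on_le) auto
  qed
  have "measure lebesgue V = (\<Sum>z\<in>G. measure lebesgue (box z (cell_corner D z)))"
    unfolding V_def
  proof (rule measure_UNION')
    show "pairwise (\<lambda>y z. disjnt (box y (cell_corner D y)) (box z (cell_corner D z))) G"
      using open_cells_disjoint[OF D] G(2) unfolding pairwise_def disjnt_def by blast
  qed (use G(1) in \<open>simp_all add: lmeasurable_box\<close>)
  also have "\<dots> = real (card G) / D" by (simp add: measure_open_cell[OF D] del: measure_completion)
  finally have "D * measure lebesgue V = real (card G)" using D by (simp only:) simp
  then have "real (card G) \<le> real (card W)"
    using translation_count_le_imp_volume_le[OF A V count] by simp
  then show "card G \<le> card (\<Union>z\<in>G. {n. norm (A n - z) \<le> K})"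
    unfolding W_def by simp
qed

theorem theorem5:
  fixes A :: "nat \<Rightarrow> real ^ 'n::finite" and D :: real
  assumes "roughly_shift_invariant A" and "has_density A D"
  shows "uniformly_spread A \<and>
    (\<exists>(C::real) \<Theta>. bij_betw \<Theta> UNIV (scaled_lattice D) \<and>
       (SUP n. ereal (norm (A n - \<Theta> n))) < ereal C)"
proof -
  have A: "discrete_multiset A" using assms(1) unfolding roughly_shift_invariant_def by blast
  have D: "D > 0" using assms(2) unfolding has_density_def by blast
  obtain L where L: "\<And>x. \<exists>\<sigma>::nat \<Rightarrow> nat. bij \<sigma> \<and> (\<forall>n. norm (A n + x - A (\<sigma> n)) < L)"
    using roughly_shift_invariant_bound[OF assms(1)] by blast
  define K where "K = L + real CARD('n) * cell_side TYPE('n) D"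
  have near: "norm (A n - z) \<le> K \<longleftrightarrow> z \<in> cball (A n) K" "norm (A n - z) \<le> K \<longleftrightarrow> A n \<in> cball z K" for n z
    by (auto simp: dist_norm norm_minus_commute)
  obtain \<Theta> where \<Theta>: "bij_betw \<Theta> UNIV (scaled_lattice D)" "\<And>n. norm (A n - \<Theta> n) \<le> K"
  proof (rule perfect_matching[of UNIV "scaled_lattice D" "\<lambda>n z. norm (A n - z) \<le> K"])
    show "hall_condition UNIV (\<lambda>n. {z \<in> scaled_lattice D. norm (A n - z) \<le> K})"
      by (rule hall_points_to_lattice[OF A assms(2) L K_def])
    show "hall_condition (scaled_lattice D) (\<lambda>z. {n \<in> UNIV. norm (A n - z) \<le> K})"
      using hall_lattice_to_points[OF A assms(2) L K_def] by simp
    show "finite {z \<in> scaled_lattice D. norm (A n - z) \<le> K}" for n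
      unfolding near(1) by (rule finite_scaled_lattice_bounded[OF D bounded_cball])
    show "finite {n \<in> UNIV. norm (A n - z) \<le> K}" for z
      unfolding near(2) using discrete_multiset_finite_bounded[OF A bounded_cball] by simp
  qed (use that in auto)
  have "(SUP n. ereal (norm (A n - \<Theta> n))) \<le> ereal K" by (rule SUP_least) (simp add: \<Theta>(2))
  then have sup: "(SUP n. ereal (norm (A n - \<Theta> n))) < ereal (K + 1)"
    by (rule le_less_trans) simp
  moreover have "uniformly_spread A"
    unfolding uniformly_spread_def
    using A D \<Theta>(1) sup[unfolded norm_minus_commute[of "A _"]] by blast
  ultimately show ?thesis using \<Theta>(1) by blast
qed

end
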